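(* Let $T$ be a propositional theory over $\mathcal V$, let $(\mathcal A,\oplus,\otimes,e^\oplus,e^\otimes)$ be a commutative semiring, and let $\alpha:\mathcal L\to\mathcal A$ be a labeling function on the literals of $\mathcal V$ such that $(\oplus,\alpha)$ is neutral, i.e. $\alpha(v)\oplus\alpha(\neg v)=e^\otimes$ for all $v\in\mathcal V$. If $N_T$ is a d-DNNF representation of $T$ (i.e. an NNF circuit over $\mathcal V$ that is deterministic and decomposable and is logically equivalent to $T$), then evaluating $N_T$ is a sound AMC computation, i.e. $$\mathrm{Eval}(N_T,\oplus,\otimes,e^\oplus,e^\otimes,\alpha)=\mathbf A(T).$$
   Context: A semiring $(\mathcal A,\oplus,\otimes,e^\oplus,e^\otimes)$ has associative binary operations $\oplus,\otimes$ on $\mathcal A$, with $\oplus$ commutative, $\otimes$ distributing over $\oplus$, $e^\oplus$ neutral for $\oplus$, $e^\otimes$ neutral for $\otimes$, and $e^\oplus\otimes a=a\otimes e^\oplus=e^\oplus$ for all $a$. It is commutative if $\otimes$ is also commutative. Algebraic model count: for a propositional theory $T$ over a finite set $\mathcal V$ of variables and $\alpha:\mathcal L\to\mathcal A$ on the set $\mathcal L$ of literals of $\mathcal V$, $$\mathbf A(T)=\bigoplus_{I\in\mathcal M(T)}\ \bigotimes_{l\in I}\alpha(l),$$ where $\mathcal M(T)$ is the set of models of $T$; a model is a set of literals containing exactly one of $v,\neg v$ for each $v\in\mathcal V$. Empty sums are $e^\oplus$, empty products $e^\otimes$. An NNF circuit over $\mathcal V$ is a finite rooted directed acyclic graph whose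 leaves are labeled with $\top$, $\bot$ or a literal of a variable in $\mathcal V$, and whose internal nodes are labeled $\vee$ or $\wedge$. Each node is identified with the formula of the subcircuit rooted at it, and its variables are those occurring in that subcircuit. The circuit is decomposable if for each conjunction node $\bigwedge_{i=1}^n\phi_i$ no two children $\phi_i,\phi_j$ ($i\ne j$) share a variable; deterministic if for each disjunction node $\bigvee_{i=1}^n\phi_i$ each two children $\phi_i,\phi_j$ ($i\ne j$) are logically inconsistent. $\mathrm{Eval}$ is defined recursively from the leaves to the root: $\top\mapsto e^\otimes$, $\bot\mapsto e^\oplus$, literal $l\mapsto\alpha(l)$, a disjunction node $\mapsto$ the $\oplus$-sum of the values of its children, a conjunction node $\mapsto$ the $\otimes$-product of the values of its children; the value of the circuit is that of its root. *)

theory Defs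
  imports Main
begin

datatype 'v literal = Pos 'v | Neg 'v

fun lit_var :: "'v literal \<Rightarrow> 'v" where
  "lit_var (Pos v) = v"
| "lit_var (Neg v) = v"

definition literals :: "'v set \<Rightarrow> 'v literal set" where
  "literals \<V> = Pos ` \<V> \<union> Neg ` \<V>"

definition interpretations :: "'v set \<Rightarrow> 'v literal set set" where
  "interpretations \<V> =
    {I. I \<subseteq> literals \<V> \<and> (\<forall>v\<in>\<V>. (Pos v \<in> I) \<noteq> (Neg v \<in> I))}"

datatype 'v form =
    FTrue
  | FFalse
  | FAtom 'v
  | FNot "'v form"
  | FAnd "'v form" "'v form"
  | FOr "'v form" "'v form"
  | FImp "'v form" "'v form"

fun form_vars :: "'v form \<Rightarrow> 'v set" where
  "form_vars FTrue = {}"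
| "form_vars FFalse = {}"
| "form_vars (FAtom v) = {v}"
| "form_vars (FNot p) = form_vars p"
| "form_vars (FAnd p q) = form_vars p \<union> form_vars q"
| "form_vars (FOr p q) = form_vars p \<union> form_vars q"
| "form_vars (FImp p q) = form_vars p \<union> form_vars q"

fun form_sat :: "'v literal set \<Rightarrow> 'v form \<Rightarrow> bool" where
  "form_sat I FTrue \<longleftrightarrow> True"
| "form_sat I FFalse \<longleftrightarrow> False"
| "form_sat I (FAtom v) \<longleftrightarrow> Pos v \<in> I"
| "form_sat I (FNot p) \<longleftrightarrow> \<not> form_sat I p"
| "form_sat I (FAnd p q) \<longleftrightarrow> form_sat I p \<and> form_sat I q"
| "form_sat I (FOr p q) \<longleftrightarrow> form_sat I p \<or> form_sat I q"
| "form_sat I (FImp p q) \<longleftrightarrow> (form_sat I p \<longrightarrow> form_sat I q)"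

definition theory_over :: "'v set \<Rightarrow> 'v form set \<Rightarrow> bool" where
  "theory_over \<V> T \<longleftrightarrow> (\<forall>p\<in>T. form_vars p \<subseteq> \<V>)"

definition models :: "'v set \<Rightarrow> 'v form set \<Rightarrow> 'v literal set set" where
  "models \<V> T = {I \<in> interpretations \<V>. \<forall>p\<in>T. form_sat I p}"

text \<open>
  A commutative semiring is a type of sort \<open>{comm_semiring_0, comm_monoid_mult}\<close>:
  unlike the class \<open>comm_semiring_1\<close>, this does not impose \<open>0 \<noteq> 1\<close>.
\<close>

definition amc ::
  "'v set \<Rightarrow> ('v literal \<Rightarrow> 'a::{comm_semiring_0, comm_monoid_mult}) \<Rightarrow> 'v form set \<Rightarrow> 'a" where
  "amc \<V> \<alpha> T = (\<Sum>I\<in>models \<V> T. \<Prod>l\<in>I. \<alpha> l)"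

definition neutral ::
  "'v set \<Rightarrow> ('v literal \<Rightarrow> 'a::{comm_semiring_0, comm_monoid_mult}) \<Rightarrow> bool" where
  "neutral \<V> \<alpha> \<longleftrightarrow> (\<forall>v\<in>\<V>. \<alpha> (Pos v) + \<alpha> (Neg v) = 1)"

datatype 'v node_label = LTop | LBot | LLit "'v literal" | LOr | LAnd

fun leaf_label :: "'v node_label \<Rightarrow> bool" where
  "leaf_label LOr \<longleftrightarrow> False"
| "leaf_label LAnd \<longleftrightarrow> False"
| "leaf_label _ \<longleftrightarrow> True"

text \<open>Edges point from a node to its children.\<close>

record ('n, 'v) circuit =
  nodes :: "'n set"
  edges :: "('n \<times> 'n) set"
  root :: 'n
  label :: "'n \<Rightarrow> 'v node_label"

definition children :: "('n, 'v) circuit \<Rightarrow> 'n \<Rightarrow> 'n set" where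
  "children N n = {m. (n, m) \<in> edges N}"

definition nnf_circuit :: "'v set \<Rightarrow> ('n, 'v) circuit \<Rightarrow> bool" where
  "nnf_circuit \<V> N \<longleftrightarrow>
    finite (nodes N) \<and>
    edges N \<subseteq> nodes N \<times> nodes N \<and>
    acyclic (edges N) \<and>
    root N \<in> nodes N \<and>
    (\<forall>n\<in>nodes N. (root N, n) \<in> (edges N)\<^sup>*) \<and>
    (\<forall>n\<in>nodes N. leaf_label (label N n) \<longleftrightarrow> children N n = {}) \<and>
    (\<forall>n\<in>nodes N. \<forall>l. label N n = LLit l \<longrightarrow> l \<in> literals \<V>)"

definition node_vars :: "('n, 'v) circuit \<Rightarrow> 'n \<Rightarrow> 'v set" where
  "node_vars N n = {lit_var l | l m. (n, m) \<in> (edges N)\<^sup>* \<and> label N m = LLit l}"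

text \<open>
  The following two functions recurse along the edges, which terminates on acyclic
  circuits only. They are therefore introduced as partial functions; the recursion
  equations for circuits are \<open>node_sat_unfold\<close> and \<open>node_value_unfold\<close> below.
\<close>

function node_sat :: "('n, 'v) circuit \<Rightarrow> 'v literal set \<Rightarrow> 'n \<Rightarrow> bool" where
  "node_sat N I n \<longleftrightarrow>
    (case label N n of
       LTop \<Rightarrow> True
     | LBot \<Rightarrow> False
     | LLit l \<Rightarrow> l \<in> I
     | LOr \<Rightarrow> (\<exists>m\<in>children N n. node_sat N I m)
     | LAnd \<Rightarrow> (\<forall>m\<in>children N n. node_sat N I m))"
  by pat_completeness auto

function node_value ::
  "('n, 'v) circuit \<Rightarrow> ('v literal \<Rightarrow> 'a::{comm_semiring_0, comm_monoid_mult}) \<Rightarrow> 'n \<Rightarrow> 'a" where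
  "node_value N \<alpha> n =
    (case label N n of
       LTop \<Rightarrow> 1
     | LBot \<Rightarrow> 0
     | LLit l \<Rightarrow> \<alpha> l
     | LOr \<Rightarrow> (\<Sum>m\<in>children N n. node_value N \<alpha> m)
     | LAnd \<Rightarrow> (\<Prod>m\<in>children N n. node_value N \<alpha> m))"
  by pat_completeness auto

lemma nnf_circuit_wf:
  assumes "nnf_circuit \<V> N"
  shows "wf ((edges N)\<inverse>)"
proof -
  have "finite (edges N)"
    using assms by (auto simp: nnf_circuit_def intro: finite_subset)
  then show ?thesis
    using assms by (simp add: nnf_circuit_def finite_acyclic_wf_converse)
qed

lemma node_sat_dom:
  assumes "nnf_circuit \<V> N"
  shows "node_sat_dom (N, I, n)"
  using nnf_circuit_wf[OF assms]
proof (induction n rule: wf_induct_rule)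
  case (less n)
  then show ?case
    by - (rule accpI, auto elim!: node_sat_rel.cases simp: children_def)
qed

lemma node_value_dom:
  assumes "nnf_circuit \<V> N"
  shows "node_value_dom (N, \<alpha>, n)"
  using nnf_circuit_wf[OF assms]
proof (induction n rule: wf_induct_rule)
  case (less n)
  then show ?case
    by - (rule accpI, auto elim!: node_value_rel.cases simp: children_def)
qed

lemmas node_sat_unfold = node_sat.psimps[OF node_sat_dom]
lemmas node_value_unfold = node_value.psimps[OF node_value_dom]

definition circuit_value ::
  "('n, 'v) circuit \<Rightarrow> ('v literal \<Rightarrow> 'a::{comm_semiring_0, comm_monoid_mult}) \<Rightarrow> 'a" where
  "circuit_value N \<alpha> = node_value N \<alpha> (root N)"

definition decomposable :: "('n, 'v) circuit \<Rightarrow> bool" where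
  "decomposable N \<longleftrightarrow>
    (\<forall>n\<in>nodes N. label N n = LAnd \<longrightarrow>
      (\<forall>m\<in>children N n. \<forall>m'\<in>children N n. m \<noteq> m' \<longrightarrow>
        node_vars N m \<inter> node_vars N m' = {}))"

definition deterministic :: "'v set \<Rightarrow> ('n, 'v) circuit \<Rightarrow> bool" where
  "deterministic \<V> N \<longleftrightarrow>
    (\<forall>n\<in>nodes N. label N n = LOr \<longrightarrow>
      (\<forall>m\<in>children N n. \<forall>m'\<in>children N n. m \<noteq> m' \<longrightarrow>
        \<not> (\<exists>I\<in>interpretations \<V>. node_sat N I m \<and> node_sat N I m')))"

definition represents :: "'v set \<Rightarrow> ('n, 'v) circuit \<Rightarrow> 'v form set \<Rightarrow> bool" where
  "represents \<V> N T \<longleftrightarrow>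
    (\<forall>I\<in>interpretations \<V>. node_sat N I (root N) \<longleftrightarrow> I \<in> models \<V> T)"

definition d_dnnf_representation :: "'v set \<Rightarrow> ('n, 'v) circuit \<Rightarrow> 'v form set \<Rightarrow> bool" where
  "d_dnnf_representation \<V> N T \<longleftrightarrow>
    nnf_circuit \<V> N \<and> deterministic \<V> N \<and> decomposable N \<and> represents \<V> N T"

end

theory Submission
  imports Defs
begin

text \<open>
  Every node \<open>n\<close> of the circuit evaluates to the weighted count, over the
  interpretations of all of \<open>\<V>\<close>, of the formula at \<open>n\<close>. Determinism makes the count
  additive at disjunctions. Weighted counts over disjoint sets of variables multiply, and
  neutrality says that the variables a formula does not mention contribute the factor 1;
  hence no smoothness is needed at disjunctions, and decomposability makes the count
  multiplicative at conjunctions.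
\<close>

section \<open>Weighted counts and dependence on a set of variables\<close>

definition wcount ::
  "'v set \<Rightarrow> ('v literal \<Rightarrow> 'a::{comm_semiring_0, comm_monoid_mult}) \<Rightarrow>
    ('v literal set \<Rightarrow> bool) \<Rightarrow> 'a" where
  "wcount \<V> \<alpha> P = (\<Sum>I\<in>{I \<in> interpretations \<V>. P I}. \<Prod>l\<in>I. \<alpha> l)"

text \<open>A semantic form of "mentions only variables in \<open>A\<close>": deleting all other
  literals does not change the truth value. It ranges over arbitrary literal sets, so it also makes
  sense for the restriction of an interpretation to \<open>A\<close>.\<close>

definition depends_on :: "'v set \<Rightarrow> ('v literal set \<Rightarrow> bool) \<Rightarrow> bool" where
  "depends_on A P \<longleftrightarrow> (\<forall>I. P I \<longleftrightarrow> P (I \<inter> literals A))"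

lemma depends_on_restrict: "depends_on A P \<Longrightarrow> P (I \<inter> literals A) \<longleftrightarrow> P I"
  by (simp only: depends_on_def)

lemma depends_onD:
  assumes "depends_on A P" "I \<inter> literals A = J \<inter> literals A"
  shows "P I \<longleftrightarrow> P J"
  using depends_on_restrict[OF assms(1), of I] depends_on_restrict[OF assms(1), of J] assms(2)
  by simp

lemma literals_mono: "A \<subseteq> B \<Longrightarrow> literals A \<subseteq> literals B"
  by (auto simp: literals_def)

lemma literals_Un: "literals (A \<union> B) = literals A \<union> literals B"
  by (auto simp: literals_def)

lemma literals_disjoint: "A \<inter> B = {} \<Longrightarrow> literals A \<inter> literals B = {}"
  by (auto simp: literals_def)

lemma in_literals_iff: "l \<in> literals A \<longleftrightarrow> lit_var l \<in> A"
  by (cases l) (auto simp: literals_def)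

lemma depends_on_mono:
  assumes "depends_on A P" "A \<subseteq> B"
  shows "depends_on B P"
  unfolding depends_on_def
proof
  fix I
  have "I \<inter> literals A = I \<inter> literals B \<inter> literals A"
    using literals_mono[OF assms(2)] by blast
  then show "P I \<longleftrightarrow> P (I \<inter> literals B)"
    by (rule depends_onD[OF assms(1)])
qed

lemma depends_on_True: "depends_on A (\<lambda>I. True)"
  by (simp add: depends_on_def)

lemma depends_on_literal: "lit_var l \<in> A \<Longrightarrow> depends_on A (\<lambda>I. l \<in> I)"
  by (simp add: depends_on_def in_literals_iff)

lemma depends_on_Ball:
  "(\<And>c. c \<in> C \<Longrightarrow> depends_on A (P c)) \<Longrightarrow> depends_on A (\<lambda>I. \<forall>c\<in>C. P c I)"
  \<comment> \<open>Only the dependence of the quantified predicate is unfolded; that of each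
    \<open>P c\<close> stays folded and serves to remove the intersection.\<close>
  by (auto simp: depends_on_def[of A "\<lambda>I. \<forall>c\<in>C. P c I"] depends_on_restrict)

lemma depends_on_Bex:
  "(\<And>c. c \<in> C \<Longrightarrow> depends_on A (P c)) \<Longrightarrow> depends_on A (\<lambda>I. \<exists>c\<in>C. P c I)"
  by (auto simp: depends_on_def[of A "\<lambda>I. \<exists>c\<in>C. P c I"] depends_on_restrict)

section \<open>Interpretations and their gluing over disjoint sets of variables\<close>

lemma finite_literals: "finite \<V> \<Longrightarrow> finite (literals \<V>)"
  by (simp add: literals_def)

lemma interpretations_subset: "I \<in> interpretations \<V> \<Longrightarrow> I \<subseteq> literals \<V>"
  by (simp add: interpretations_def)

lemma finite_interpretation: "finite \<V> \<Longrightarrow> I \<in> interpretations \<V> \<Longrightarrow> finite I"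
  by (meson finite_literals finite_subset interpretations_subset)

lemma finite_interpretations: "finite \<V> \<Longrightarrow> finite (interpretations \<V>)"
  by (rule finite_subset[of _ "Pow (literals \<V>)"])
    (auto simp: interpretations_def finite_literals)

lemma interpretations_restrict:
  "K \<in> interpretations \<V> \<Longrightarrow> A \<subseteq> \<V> \<Longrightarrow> K \<inter> literals A \<in> interpretations A"
  by (auto simp: interpretations_def literals_def)

text \<open>Disjoint variable sets leave no room for a clash: the polarity of a variable is decided
  by one piece alone, and each piece is recovered from the union by restriction.\<close>

lemma interpretations_Un:
  assumes "I \<in> interpretations A" "J \<in> interpretations B" "A \<inter> B = {}"
  shows "I \<union> J \<in> interpretations (A \<union> B)"
    and "(I \<union> J) \<inter> literals A = I"
    and "(I \<union> J) \<inter> literals B = J"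
    and "I \<inter> J = {}"
proof -
  note sub = interpretations_subset[OF assms(1)] interpretations_subset[OF assms(2)]
    and disj = literals_disjoint[OF assms(3)]
  show A: "(I \<union> J) \<inter> literals A = I" and B: "(I \<union> J) \<inter> literals B = J" and "I \<inter> J = {}"
    using sub disj by blast+
  have "(Pos v \<in> I \<union> J) \<noteq> (Neg v \<in> I \<union> J)" if "v \<in> A \<union> B" for v
  proof (cases "v \<in> A")
    case True
    then have "(Pos v \<in> I) \<noteq> (Neg v \<in> I)" "{Pos v, Neg v} \<subseteq> literals A"
      using assms(1) by (auto simp: interpretations_def in_literals_iff)
    then show ?thesis using A by blast
  next
    case False
    then have "(Pos v \<in> J) \<noteq> (Neg v \<in> J)" "{Pos v, Neg v} \<subseteq> literals B"
      using assms(2) that by (auto simp: interpretations_def in_literals_iff)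
    then show ?thesis using B by blast
  qed
  then show "I \<union> J \<in> interpretations (A \<union> B)"
    using sub by (auto simp: interpretations_def literals_Un)
qed

text \<open>Expanding the product of the two sums gives a sum over pairs. Gluing is a bijection from
  pairs to interpretations of \<open>A \<union> B\<close>; it multiplies the weights because the
  pieces are disjoint, and \<open>P\<close> and \<open>Q\<close> each see only their own
  piece.\<close>

lemma wcount_Un:
  fixes \<alpha> :: "'v literal \<Rightarrow> 'a::{comm_semiring_0, comm_monoid_mult}"
  assumes "finite A" "finite B" "A \<inter> B = {}" "depends_on A P" "depends_on B Q"
  shows "wcount (A \<union> B) \<alpha> (\<lambda>I. P I \<and> Q I) = wcount A \<alpha> P * wcount B \<alpha> Q"
proof -
  let ?A = "{I \<in> interpretations A. P I}" and ?B = "{I \<in> interpretations B. Q I}"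
  have iff: "P (I \<union> J) \<longleftrightarrow> P I" "Q (I \<union> J) \<longleftrightarrow> Q J"
    if "I \<in> interpretations A" "J \<in> interpretations B" for I J
    using depends_on_restrict[OF assms(4), of "I \<union> J"]
      depends_on_restrict[OF assms(5), of "I \<union> J"]
      interpretations_Un(2,3)[OF that assms(3)] by simp_all
  have "wcount A \<alpha> P * wcount B \<alpha> Q =
      (\<Sum>(I, J)\<in>?A \<times> ?B. (\<Prod>l\<in>I. \<alpha> l) * (\<Prod>l\<in>J. \<alpha> l))"
    by (simp add: wcount_def sum_product sum.cartesian_product)
  also have "\<dots> = wcount (A \<union> B) \<alpha> (\<lambda>I. P I \<and> Q I)"
    unfolding wcount_def
  proof (rule sum.reindex_bij_witness[where
        i = "\<lambda>K. (K \<inter> literals A, K \<inter> literals B)" and j = "\<lambda>(I, J). I \<union> J"])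
    fix p assume "p \<in> ?A \<times> ?B"
    then obtain I J where p: "p = (I, J)"
      and I: "I \<in> interpretations A" "P I" and J: "J \<in> interpretations B" "Q J"
      by blast
    note IJ = interpretations_Un[OF I(1) J(1) assms(3)]
    show "(\<lambda>K. (K \<inter> literals A, K \<inter> literals B)) (case p of (I, J) \<Rightarrow> I \<union> J) = p"
      by (simp add: p IJ(2,3))
    show "(case p of (I, J) \<Rightarrow> I \<union> J) \<in> {I \<in> interpretations (A \<union> B). P I \<and> Q I}"
      using IJ(1) iff[OF I(1) J(1)] I J by (simp add: p)
    show "(\<Prod>l\<in>(case p of (I, J) \<Rightarrow> I \<union> J). \<alpha> l) =
        (case p of (I, J) \<Rightarrow> (\<Prod>l\<in>I. \<alpha> l) * (\<Prod>l\<in>J. \<alpha> l))"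
      using prod.union_disjoint[OF finite_interpretation[OF assms(1) I(1)]
          finite_interpretation[OF assms(2) J(1)] IJ(4)] by (simp add: p)
  next
    fix K assume K: "K \<in> {I \<in> interpretations (A \<union> B). P I \<and> Q I}"
    then have "K \<subseteq> literals A \<union> literals B"
      using interpretations_subset literals_Un by blast
    then show "(case (K \<inter> literals A, K \<inter> literals B) of (I, J) \<Rightarrow> I \<union> J) = K"
      by auto
    show "(K \<inter> literals A, K \<inter> literals B) \<in> ?A \<times> ?B"
      using K interpretations_restrict[of K "A \<union> B"]
      by (auto simp: depends_on_restrict[OF assms(4)] depends_on_restrict[OF assms(5)])
  qed
  finally show ?thesis ..
qed

section \<open>Weighted counts under neutrality\<close>

lemma interpretations_empty: "interpretations {} = {{}}"
  by (auto simp: interpretations_def literals_def)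

lemma interpretations_singleton: "interpretations {v} = {{Pos v}, {Neg v}}"
  by (auto simp: interpretations_def literals_def)

text \<open>The total weight factors into one sum \<open>\<alpha> (Pos v) + \<alpha> (Neg v)\<close>
  per variable, and each of these is 1.\<close>

lemma wcount_True:
  assumes "finite \<V>" "neutral \<V> \<alpha>"
  shows "wcount \<V> \<alpha> (\<lambda>I. True) = 1"
  using assms
proof (induction rule: finite_induct)
  case empty
  show ?case by (simp add: wcount_def interpretations_empty)
next
  case (insert v W)
  \<comment> \<open>The doubled \<open>True\<close> brings the count into the shape of
    \<open>wcount_Un\<close>.\<close>
  have "wcount ({v} \<union> W) \<alpha> (\<lambda>I. True \<and> True) =
      wcount {v} \<alpha> (\<lambda>I. True) * wcount W \<alpha> (\<lambda>I. True)"
    using insert.hyps by (intro wcount_Un depends_on_True) auto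
  moreover have "wcount {v} \<alpha> (\<lambda>I. True) = (\<Sum>I\<in>{{Pos v}, {Neg v}}. \<Prod>l\<in>I. \<alpha> l)"
    by (simp only: wcount_def interpretations_singleton simp_thms Collect_mem_eq)
  ultimately show ?case
    using insert by (simp add: neutral_def)
qed

lemma neutral_subset: "neutral \<V> \<alpha> \<Longrightarrow> A \<subseteq> \<V> \<Longrightarrow> neutral A \<alpha>"
  by (auto simp: neutral_def)

text \<open>The variables outside \<open>A\<close> are unconstrained, so they split off as a factor
  of total weight 1. This takes the place of smoothing.\<close>

lemma wcount_restrict:
  assumes "finite \<V>" "neutral \<V> \<alpha>" "A \<subseteq> \<V>" "depends_on A P"
  shows "wcount \<V> \<alpha> P = wcount A \<alpha> P"
proof -
  have "wcount (A \<union> (\<V> - A)) \<alpha> (\<lambda>I. P I \<and> True) =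
      wcount A \<alpha> P * wcount (\<V> - A) \<alpha> (\<lambda>I. True)"
    using assms by (intro wcount_Un depends_on_True) (auto intro: finite_subset)
  moreover have "wcount (\<V> - A) \<alpha> (\<lambda>I. True) = 1"
    using assms by (intro wcount_True) (auto intro: neutral_subset)
  moreover have "A \<union> (\<V> - A) = \<V>"
    using assms(3) by blast
  ultimately show ?thesis by simp
qed

text \<open>\<open>A\<close> and \<open>B\<close> need not exhaust \<open>\<V>\<close>: the count is
  first cut down to \<open>A \<union> B\<close>, factored there, and each factor is then enlarged
  back to \<open>\<V>\<close>.\<close>

lemma wcount_conj:
  assumes "finite \<V>" "neutral \<V> \<alpha>" "A \<subseteq> \<V>" "B \<subseteq> \<V>" "A \<inter> B = {}"
    and P: "depends_on A P" and Q: "depends_on B Q"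
  shows "wcount \<V> \<alpha> (\<lambda>I. P I \<and> Q I) = wcount \<V> \<alpha> P * wcount \<V> \<alpha> Q"
proof -
  have "depends_on (A \<union> B) (\<lambda>I. P I \<and> Q I)"
    using depends_on_restrict[OF depends_on_mono[OF P, of "A \<union> B"]]
      depends_on_restrict[OF depends_on_mono[OF Q, of "A \<union> B"]]
    by (simp add: depends_on_def[of _ "\<lambda>I. P I \<and> Q I"])
  then have "wcount \<V> \<alpha> (\<lambda>I. P I \<and> Q I) = wcount (A \<union> B) \<alpha> (\<lambda>I. P I \<and> Q I)"
    using assms by (intro wcount_restrict) auto
  also have "\<dots> = wcount A \<alpha> P * wcount B \<alpha> Q"
    using assms by (intro wcount_Un) (auto intro: finite_subset)
  also have "\<dots> = wcount \<V> \<alpha> P * wcount \<V> \<alpha> Q"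
    using assms by (simp add: wcount_restrict)
  finally show ?thesis .
qed

lemma wcount_Ball:
  assumes "finite \<V>" "neutral \<V> \<alpha>" "finite C"
    and "\<And>c. c \<in> C \<Longrightarrow> S c \<subseteq> \<V>"
    and "\<And>c. c \<in> C \<Longrightarrow> depends_on (S c) (P c)"
    and "\<And>c d. c \<in> C \<Longrightarrow> d \<in> C \<Longrightarrow> c \<noteq> d \<Longrightarrow> S c \<inter> S d = {}"
  shows "wcount \<V> \<alpha> (\<lambda>I. \<forall>c\<in>C. P c I) = (\<Prod>c\<in>C. wcount \<V> \<alpha> (P c))"
  using assms(3-6)
proof (induction rule: finite_induct)
  case empty
  show ?case by (simp add: wcount_True assms)
next
  case (insert c C)
  \<comment> \<open>The remaining conjuncts are treated as one predicate, whose variables are still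
    disjoint from \<open>S c\<close>.\<close>
  have "depends_on (\<Union>(S ` C)) (\<lambda>I. \<forall>d\<in>C. P d I)"
    using insert.prems(2) by (intro depends_on_Ball) (blast intro: depends_on_mono)
  moreover have "S c \<inter> S d = {}" if "d \<in> C" for d
    using insert.hyps(2) insert.prems(3)[of c d] that by blast
  ultimately have "wcount \<V> \<alpha> (\<lambda>I. P c I \<and> (\<forall>d\<in>C. P d I)) =
      wcount \<V> \<alpha> (P c) * wcount \<V> \<alpha> (\<lambda>I. \<forall>d\<in>C. P d I)"
    using insert.prems assms(1,2)
    by (intro wcount_conj[where A = "S c" and B = "\<Union>(S ` C)"]) auto
  moreover have "wcount \<V> \<alpha> (\<lambda>I. \<forall>d\<in>C. P d I) = (\<Prod>d\<in>C. wcount \<V> \<alpha> (P d))"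
    using insert.prems by (intro insert.IH) auto
  ultimately show ?case
    using insert.hyps by simp
qed

text \<open>Mutual exclusion on \<open>interpretations \<V>\<close> makes the satisfying
  interpretations a disjoint union, so no weight is counted twice.\<close>

lemma wcount_Bex:
  assumes "finite \<V>" "finite C"
    and disj: "\<And>c d I. c \<in> C \<Longrightarrow> d \<in> C \<Longrightarrow> c \<noteq> d \<Longrightarrow> I \<in> interpretations \<V> \<Longrightarrow> \<not> (P c I \<and> P d I)"
  shows "wcount \<V> \<alpha> (\<lambda>I. \<exists>c\<in>C. P c I) = (\<Sum>c\<in>C. wcount \<V> \<alpha> (P c))"
proof -
  have "{I \<in> interpretations \<V>. \<exists>c\<in>C. P c I} = (\<Union>c\<in>C. {I \<in> interpretations \<V>. P c I})"
    by blast
  then show ?thesis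
    unfolding wcount_def
    using assms(2) finite_interpretations[OF assms(1)] disj
    by (simp only:) (rule sum.UNION_disjoint, auto)
qed

text \<open>After restriction to the variable of \<open>l\<close>, the only satisfying
  interpretation is \<open>{l}\<close>.\<close>

lemma wcount_literal:
  assumes "finite \<V>" "neutral \<V> \<alpha>" "l \<in> literals \<V>"
  shows "wcount \<V> \<alpha> (\<lambda>I. l \<in> I) = \<alpha> l"
proof -
  have "wcount \<V> \<alpha> (\<lambda>I. l \<in> I) = wcount {lit_var l} \<alpha> (\<lambda>I. l \<in> I)"
    using assms by (intro wcount_restrict depends_on_literal) (auto simp: in_literals_iff)
  also have "{I \<in> interpretations {lit_var l}. l \<in> I} = {{l}}"
    by (cases l) (auto simp: interpretations_singleton)
  then have "wcount {lit_var l} \<alpha> (\<lambda>I. l \<in> I) = \<alpha> l"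
    by (simp add: wcount_def)
  finally show ?thesis .
qed

section \<open>Circuits: variables, satisfaction and evaluation\<close>

lemma children_subset: "nnf_circuit \<V> N \<Longrightarrow> children N n \<subseteq> nodes N"
  by (auto simp: nnf_circuit_def children_def)

lemma finite_children: "nnf_circuit \<V> N \<Longrightarrow> finite (children N n)"
  using children_subset finite_subset unfolding nnf_circuit_def by metis

lemma node_vars_child: "m \<in> children N n \<Longrightarrow> node_vars N m \<subseteq> node_vars N n"
  by (auto simp: node_vars_def children_def intro: converse_rtrancl_into_rtrancl)

lemma node_vars_subset:
  assumes "nnf_circuit \<V> N" "n \<in> nodes N"
  shows "node_vars N n \<subseteq> \<V>"
proof -
  \<comment> \<open>Labels are constrained only on \<open>nodes N\<close>, so every node reachable
    from \<open>n\<close> must be shown to lie there.\<close>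
  have "m \<in> nodes N" if "(n, m) \<in> (edges N)\<^sup>*" for m
    using that
    by (induction rule: rtrancl_induct) (use assms in \<open>auto simp: nnf_circuit_def\<close>)
  then show ?thesis
    using assms(1) by (auto simp: nnf_circuit_def node_vars_def in_literals_iff)
qed

text \<open>Induction from the leaves upward: the variables of a child are among those of its
  parent, so dependence passes to the parent by monotonicity.\<close>

lemma depends_on_node_sat:
  assumes "nnf_circuit \<V> N"
  shows "depends_on (node_vars N n) (\<lambda>I. node_sat N I n)"
  using nnf_circuit_wf[OF assms]
proof (induction n rule: wf_induct_rule)
  case (less n)
  have child: "depends_on (node_vars N n) (\<lambda>I. node_sat N I m)" if "m \<in> children N n" for m
    using less[of m] that node_vars_child[OF that]
    by (auto simp: children_def intro: depends_on_mono)
  note unfold = node_sat_unfold[OF assms, of _ n]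
  show ?case
  proof (cases "label N n")
    case (LLit l)
    then have "lit_var l \<in> node_vars N n"
      by (auto simp: node_vars_def)
    then show ?thesis
      using LLit by (simp add: unfold depends_on_literal)
  next
    case LOr
    then show ?thesis
      using child by (simp add: unfold depends_on_Bex)
  next
    case LAnd
    then show ?thesis
      using child by (simp add: unfold depends_on_Ball)
  qed (simp_all add: unfold depends_on_def)
qed

text \<open>Counting over all of \<open>\<V>\<close> at every node lets the induction hypotheses for
  children with different variables speak of the same interpretations.\<close>

lemma node_value_eq_wcount:
  assumes "finite \<V>" "neutral \<V> \<alpha>"
    and N: "nnf_circuit \<V> N" "deterministic \<V> N" "decomposable N"
    and "n \<in> nodes N"
  shows "node_value N \<alpha> n = wcount \<V> \<alpha> (\<lambda>I. node_sat N I n)"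
  using nnf_circuit_wf[OF N(1)] assms(6)
proof (induction n rule: wf_induct_rule)
  case (less n)
  have nodes: "m \<in> nodes N" if "m \<in> children N n" for m
    using children_subset[OF N(1)] that by blast
  have IH: "node_value N \<alpha> m = wcount \<V> \<alpha> (\<lambda>I. node_sat N I m)" if "m \<in> children N n" for m
    using less.IH[of m] nodes[OF that] that by (simp add: children_def)
  note fin = finite_children[OF N(1), of n]
  note unfold = node_sat_unfold[OF N(1), of _ n] node_value_unfold[OF N(1), of \<alpha> n]
  show ?case
  proof (cases "label N n")
    \<comment> \<open>The value 1 is the total weight of all interpretations, by neutrality.\<close>
    case LTop
    then show ?thesis by (simp add: unfold wcount_True assms)
  next
    case LBot
    then show ?thesis by (simp add: unfold wcount_def)
  next
    case (LLit l)
    then have "l \<in> literals \<V>"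
      using N(1) less.prems by (auto simp: nnf_circuit_def)
    then show ?thesis using LLit by (simp add: unfold wcount_literal assms)
  next
    case LOr
    then have "wcount \<V> \<alpha> (\<lambda>I. \<exists>m\<in>children N n. node_sat N I m) =
        (\<Sum>m\<in>children N n. wcount \<V> \<alpha> (\<lambda>I. node_sat N I m))"
      using N(2) less.prems assms(1) fin
      by (intro wcount_Bex) (auto simp: deterministic_def)
    then show ?thesis using LOr IH by (simp add: unfold)
  next
    case LAnd
    \<comment> \<open>Decomposability supplies the pairwise disjoint sets for
      \<open>wcount_Ball\<close>, with \<open>node_vars N\<close> as the family
      \<open>S\<close>.\<close>
    then have "node_vars N m \<inter> node_vars N m' = {}"
      if "m \<in> children N n" "m' \<in> children N n" "m \<noteq> m'" for m m'
      using N(3) less.prems that by (simp add: decomposable_def)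
    then have "wcount \<V> \<alpha> (\<lambda>I. \<forall>m\<in>children N n. node_sat N I m) =
        (\<Prod>m\<in>children N n. wcount \<V> \<alpha> (\<lambda>I. node_sat N I m))"
      using assms(1,2) fin nodes
      by (intro wcount_Ball[where S = "node_vars N"] depends_on_node_sat[OF N(1)]
          node_vars_subset[OF N(1)])
    then show ?thesis using LAnd IH by (simp add: unfold)
  qed
qed

theorem theorem4:
  fixes \<V> :: "'v set"
    and T :: "'v form set"
    and \<alpha> :: "'v literal \<Rightarrow> 'a::{comm_semiring_0, comm_monoid_mult}"
    and N :: "('n, 'v) circuit"
  assumes "finite \<V>"
    and "theory_over \<V> T"
    and "neutral \<V> \<alpha>"
    and "d_dnnf_representation \<V> N T"
  shows "circuit_value N \<alpha> = amc \<V> \<alpha> T"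
proof -
  have N: "nnf_circuit \<V> N" "deterministic \<V> N" "decomposable N" "represents \<V> N T"
    using assms(4) by (simp_all add: d_dnnf_representation_def)
  have "root N \<in> nodes N"
    using N(1) by (simp add: nnf_circuit_def)
  then have "circuit_value N \<alpha> = wcount \<V> \<alpha> (\<lambda>I. node_sat N I (root N))"
    using node_value_eq_wcount[OF assms(1,3) N(1-3)] by (simp add: circuit_value_def)
  \<comment> \<open>Equivalence on interpretations suffices for equality of the sets, since models
    are interpretations by definition.\<close>
  also have "{I \<in> interpretations \<V>. node_sat N I (root N)} = models \<V> T"
    using N(4) by (auto simp: represents_def models_def)
  then have "wcount \<V> \<alpha> (\<lambda>I. node_sat N I (root N)) = amc \<V> \<alpha> T"
    by (simp add: wcount_def amc_def)
  finally show ?thesis .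
qed

end
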